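(* Let $0<\delta,\epsilon,\xi<\pi$ and suppose that $-\alpha=\ell\in\{1,2,\ldots\}$, where $\alpha=(\delta+\epsilon-\pi)/\xi$. Then for any $\mu\in\mathbb{R}^2\setminus\{0\}$ with $\theta_\mu\in\Theta_\ell$ there is a finite nonzero constant $C^\mu$, independent of $r$ and $\theta$, such that for any $\theta\in[0,\xi]$, \[ \pi^\mu(rw_\theta)\sim C^\mu r^\ell\sin(\ell\theta+\delta)\qquad\text{as } r\to0, \] i.e. the ratio of the two sides tends to $1$ as $r\downarrow 0$.
   Context: Notation. $w_\theta=(\cos\theta,\sin\theta)$; $e_1=(1,0)$; $\langle\cdot,\cdot\rangle$ is the Euclidean inner product; vectors are column vectors. The wedge is $S=\{x\in\mathbb{R}^2:0\le\arg(x)\le\xi\}$ (including the origin). $v_1=w_\delta/\sin\delta$. For $\mu\in\mathbb{R}^2\setminus\{0\}$, $\theta_\mu=\arg(\mu)\in(-\pi,\pi]$. $R_\theta=\begin{pmatrix}\cos2\theta&\sin2\theta\\ \sin2\theta&-\cos2\theta\end{pmatrix}$, $\rho_\theta=\begin{pmatrix}\cos\theta&-\sin\theta\\ \sin\theta&\cos\theta\end{pmatrix}$, and for integers $k\ge0$, $\mathrm{Rot}_k=\rho_{2\delta+2k\xi}$, $\mathrm{Ref}_k=\rho_{2\delta+2(k-1)\xi}R_\xi$. Also \[ \Theta_\ell=\{\theta\in(\xi-\epsilon,\delta):\sin(\theta-2\delta-k\xi)\ne0\text{ for }k=0,\dots,2\ell\}. \] For $x\in S$ and $j\ge0$, \[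 \pi^\mu_j(x)=\frac{\langle\mu,(I-\mathrm{Rot}_j)v_1\rangle e^{-\langle\mu,(I-\mathrm{Rot}_j)x\rangle}-\langle\mu,(I-\mathrm{Ref}_j)v_1\rangle e^{-\langle\mu,(I-\mathrm{Ref}_j)x\rangle}}{\langle\mu,(\mathrm{Ref}_j-\mathrm{Rot}_j)v_1\rangle}, \] and $\pi^\mu(x)$ is the $(\ell+1)\times(\ell+1)$ determinant, with columns indexed by $j=0,\dots,\ell$, whose first row is $(\pi^\mu_0(x),\dots,\pi^\mu_\ell(x))$ and whose subsequent rows are $(\langle\mu,\mathrm{Rot}_je_1\rangle^{m})_{j=0,\dots,\ell}$ for $m=\ell-1,\ell-2,\dots,1,0$ in this order (so the last row consists of ones). *)

theory Defs
  imports
    "Jordan_Normal_Form.Determinant"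
    "HOL-Library.Landau_Symbols"
    "HOL-Analysis.Analysis"
begin

(* Plane vectors and 2x2 matrices are those of HOL-Analysis (real^2, real^2^2).  Only the
   determinant of size l + 1, whose size varies with l, uses Jordan_Normal_Form; its clashing
   names and notation are suppressed, leaving Matrix.mat and Determinant.det. *)

no_notation Matrix.vec_index (infixl \<open>$\<close> 100)
no_notation Matrix.scalar_prod (infix \<open>\<bullet>\<close> 70)
hide_const (open) Matrix.mat Matrix.vec Matrix.row Matrix.col Determinant.det

definition alpha :: "real \<Rightarrow> real \<Rightarrow> real \<Rightarrow> real" where
  "alpha \<delta> \<epsilon> \<xi> = (\<delta> + \<epsilon> - pi) / \<xi>"

definition w :: "real \<Rightarrow> real^2" where
  "w \<theta> = vector [cos \<theta>, sin \<theta>]"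

definition e1 :: "real^2" where
  "e1 = vector [1, 0]"

definition v1 :: "real \<Rightarrow> real^2" where
  "v1 \<delta> = (1 / sin \<delta>) *\<^sub>R w \<delta>"

(* Arg takes values in {-pi<..pi}; its value at the origin (Arg 0 = 0) is never relevant. *)
definition theta_of :: "real^2 \<Rightarrow> real" where
  "theta_of \<mu> = Arg (Complex (\<mu> $ 1) (\<mu> $ 2))"

definition Refl :: "real \<Rightarrow> real^2^2" where
  "Refl \<theta> = vector [vector [cos (2 * \<theta>), sin (2 * \<theta>)],
                   vector [sin (2 * \<theta>), - cos (2 * \<theta>)]]"

definition rho :: "real \<Rightarrow> real^2^2" where
  "rho \<theta> = vector [vector [cos \<theta>, - sin \<theta>],
                  vector [sin \<theta>, cos \<theta>]]"

definition Rot :: "real \<Rightarrow> real \<Rightarrow> nat \<Rightarrow> real^2^2" where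
  "Rot \<delta> \<xi> k = rho (2 * \<delta> + 2 * real k * \<xi>)"

definition Ref :: "real \<Rightarrow> real \<Rightarrow> nat \<Rightarrow> real^2^2" where
  "Ref \<delta> \<xi> k = rho (2 * \<delta> + 2 * (real k - 1) * \<xi>) ** Refl \<xi>"

definition Theta :: "real \<Rightarrow> real \<Rightarrow> real \<Rightarrow> nat \<Rightarrow> real set" where
  "Theta \<delta> \<epsilon> \<xi> l =
     {\<theta> \<in> {\<xi> - \<epsilon><..<\<delta>}. \<forall>k\<in>{0..2 * l}. sin (\<theta> - 2 * \<delta> - real k * \<xi>) \<noteq> 0}"

definition pi_comp :: "real \<Rightarrow> real \<Rightarrow> real^2 \<Rightarrow> nat \<Rightarrow> real^2 \<Rightarrow> real" where
  "pi_comp \<delta> \<xi> \<mu> j x =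
     ((\<mu> \<bullet> ((mat 1 - Rot \<delta> \<xi> j) *v v1 \<delta>)) * exp (- (\<mu> \<bullet> ((mat 1 - Rot \<delta> \<xi> j) *v x)))
      - (\<mu> \<bullet> ((mat 1 - Ref \<delta> \<xi> j) *v v1 \<delta>)) * exp (- (\<mu> \<bullet> ((mat 1 - Ref \<delta> \<xi> j) *v x))))
     / (\<mu> \<bullet> ((Ref \<delta> \<xi> j - Rot \<delta> \<xi> j) *v v1 \<delta>))"

(* Rows are indexed from 0, so row i \<ge> 1 carries the exponent m = l - i. *)
definition pi_mu :: "real \<Rightarrow> real \<Rightarrow> nat \<Rightarrow> real^2 \<Rightarrow> real^2 \<Rightarrow> real" where
  "pi_mu \<delta> \<xi> l \<mu> x =
     Determinant.det (Matrix.mat (l + 1) (l + 1) (\<lambda>(i, j).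
       if i = 0 then pi_comp \<delta> \<xi> \<mu> j x else (\<mu> \<bullet> (Rot \<delta> \<xi> j *v e1)) ^ (l - i)))"

end

theory Submission
  imports Defs
begin

text \<open>
  Let x_j be the inner product of \<mu> with Rot_j e_1, let y_j be the corresponding sine component,
  and factor exp (- \<mu> \<bullet> x), which tends to 1, out of the first row. The m-th Taylor
  coefficient in r of the remaining first row is a polynomial of degree at most m in x_j, whose
  coefficient at x_j^m is sin (m \<theta> + \<delta>) / (m! sin \<delta>): its numerator is odd in y_j, so the
  denominator 2 y_j cancels, and y_j^2 = |\<mu>|^2 - x_j^2. As the other rows span the polynomials
  of degree below l in x_j, the Taylor coefficients with m < l contribute nothing to the
  determinant, and the one with m = l contributes a Vandermonde determinant times
  sin (l \<theta> + \<delta>) / (l! sin \<delta>). The conditions defining \<Theta>_l make the y_j nonzero and,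
  together with l \<xi> < \<pi>, the x_j distinct.
\<close>

section \<open>Small-argument expansion of sums of exponentials\<close>

lemma exp_taylor_remainder_tendsto:
  fixes q :: real
  shows "((\<lambda>r. (exp (r * q) - (\<Sum>k\<le>l. (r * q) ^ k / fact k)) / r ^ l) \<longlongrightarrow> 0) (at_right 0)"
proof (rule Lim_null_comparison)
  \<comment> \<open>The remainder bound of order l + 1 divided by \<open>r ^ l\<close>; one factor
    \<open>r\<close> is left over.\<close>
  let ?g = "\<lambda>r. exp \<bar>r * q\<bar> * \<bar>q\<bar> ^ Suc l / fact l * r"
  show "(?g \<longlongrightarrow> 0) (at_right 0)"
    by (auto intro!: tendsto_eq_intros)
  show "eventually (\<lambda>r. norm ((exp (r * q) - (\<Sum>k\<le>l. (r * q) ^ k / fact k)) / r ^ l) \<le> ?g r) (at_right 0)"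
    using eventually_at_right_less[of 0]
  proof eventually_elim
    case (elim r)
    have "\<bar>exp (r * q) - (\<Sum>k\<le>l. (r * q) ^ k / fact k)\<bar> \<le> exp \<bar>r * q\<bar> * \<bar>r * q\<bar> ^ Suc l / fact l"
      using Taylor_exp_field[of "r * q" l] by simp
    also have "\<dots> = ?g r * r ^ l"
      using elim by (simp add: abs_mult power_mult_distrib)
    finally show ?case
      using elim by (simp add: divide_le_eq)
  qed
qed

text \<open>Up to order l, the coefficient of \<open>r ^ m\<close> is the m-th moment over
  \<open>fact m\<close>. By \<open>vanish\<close> only m = l survives, and the remainders are
  o(\<open>r ^ l\<close>). Later \<open>c\<close> holds cofactors and \<open>d\<close> the
  denominators of \<open>pi_comp\<close>.\<close>

lemma exp_sum_tendsto:
  fixes c d A B a b :: "'i \<Rightarrow> real"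
  assumes vanish: "\<And>m. m < l \<Longrightarrow> (\<Sum>j\<in>J. (A j * a j ^ m - B j * b j ^ m) / d j * c j) = 0"
  shows "((\<lambda>r. (\<Sum>j\<in>J. (A j * exp (r * a j) - B j * exp (r * b j)) / d j * c j) / r ^ l)
    \<longlongrightarrow> (\<Sum>j\<in>J. (A j * a j ^ l - B j * b j ^ l) / d j * c j) / fact l) (at_right 0)"
proof -
  define M where "M m = (\<Sum>j\<in>J. (A j * a j ^ m - B j * b j ^ m) / d j * c j)" for m
  define T where "T q r = (\<Sum>k\<le>l. (r * q) ^ k / fact k)" for q r :: real
  define R where "R q r = (exp (r * q) - T q r) / r ^ l" for q r :: real
  have R: "((\<lambda>r. R q r) \<longlongrightarrow> 0) (at_right 0)" for q
    unfolding R_def T_def by (rule exp_taylor_remainder_tendsto)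
  have lim: "((\<lambda>r. M l / fact l + (\<Sum>j\<in>J. (A j * R (a j) r - B j * R (b j) r) / d j * c j))
      \<longlongrightarrow> M l / fact l + (\<Sum>j\<in>J. (A j * 0 - B j * 0) / d j * c j)) (at_right 0)"
    \<comment> \<open>As multiplication by a constant inverse, the division avoids the side
      condition \<open>d j \<noteq> 0\<close> of the quotient rule.\<close>
    unfolding divide_inverse[of _ "d _"] by (intro tendsto_intros R)
  have T_sum: "(\<Sum>j\<in>J. (A j * T (a j) r - B j * T (b j) r) / d j * c j) = r ^ l / fact l * M l" for r
  proof -
    have "(\<Sum>j\<in>J. (A j * T (a j) r - B j * T (b j) r) / d j * c j)
        = (\<Sum>j\<in>J. \<Sum>k\<le>l. r ^ k / fact k * ((A j * a j ^ k - B j * b j ^ k) / d j * c j))"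
      unfolding T_def sum_distrib_left sum_subtractf[symmetric] sum_divide_distrib sum_distrib_right
      by (intro sum.cong refl) (simp add: field_simps power_mult_distrib)
    also have "\<dots> = (\<Sum>k\<le>l. r ^ k / fact k * M k)"
      by (subst sum.swap) (simp add: M_def sum_distrib_left)
    also have "\<dots> = (\<Sum>k\<in>{l}. r ^ k / fact k * M k)"
      using vanish by (intro sum.mono_neutral_right) (auto simp: M_def)
    finally show ?thesis by simp
  qed
  have eq: "(\<Sum>j\<in>J. (A j * exp (r * a j) - B j * exp (r * b j)) / d j * c j) / r ^ l
      = M l / fact l + (\<Sum>j\<in>J. (A j * R (a j) r - B j * R (b j) r) / d j * c j)" if "r > 0" for r
  proof -
    have e: "exp (r * q) = T q r + r ^ l * R q r" for q
      using that by (simp add: R_def)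
    have "(\<Sum>j\<in>J. (A j * exp (r * a j) - B j * exp (r * b j)) / d j * c j)
        = (\<Sum>j\<in>J. (A j * T (a j) r - B j * T (b j) r) / d j * c j
             + r ^ l * ((A j * R (a j) r - B j * R (b j) r) / d j * c j))"
      unfolding e by (intro sum.cong refl) (simp add: algebra_simps diff_divide_distrib add_divide_distrib)
    also have "\<dots> = r ^ l * (M l / fact l + (\<Sum>j\<in>J. (A j * R (a j) r - B j * R (b j) r) / d j * c j))"
      unfolding sum.distrib T_sum sum_distrib_left[symmetric] by (simp add: distrib_left)
    finally show ?thesis using that by simp
  qed
  have "eventually (\<lambda>r. (\<Sum>j\<in>J. (A j * exp (r * a j) - B j * exp (r * b j)) / d j * c j) / r ^ l
      = M l / fact l + (\<Sum>j\<in>J. (A j * R (a j) r - B j * R (b j) r) / d j * c j)) (at_right 0)"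
    using eventually_at_right_less[of 0] by eventually_elim (rule eq)
  from tendsto_cong[OF this] lim show ?thesis by (simp add: M_def)
qed

section \<open>Powers and moments as polynomials in x\<close>

text \<open>The two bases are exchanged by y -> -y, and replacing y^2 by N - x^2 splits their powers
  into an even part P(x) and an odd part y Q(x). To leading order y^2 is -x^2, so y acts like i x
  and de Moivre's formula predicts the top coefficients. Since Q has degree below m, its bounds are
  put on \<open>pCons 0 Q\<close>, which also makes sense for m = 0.\<close>

lemma cos_add_power_polys:
  fixes t N :: real
  shows "\<exists>P Q :: real poly.
    (\<forall>k>m. coeff P k = 0) \<and> coeff P m = cos (m * t) \<and>
    (\<forall>k>m. coeff (pCons 0 Q) k = 0) \<and> coeff (pCons 0 Q) m = sin (m * t) \<and>
    (\<forall>x y. x\<^sup>2 + y\<^sup>2 = N \<longrightarrow>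
      (x * cos t - y * sin t) ^ m = poly P x - y * poly Q x \<and>
      (x * cos t + y * sin t) ^ m = poly P x + y * poly Q x)"
proof (induction m)
  case 0
  show ?case by (rule exI[of _ 1], rule exI[of _ 0]) simp
next
  case (Suc m)
  then obtain P Q :: "real poly" where
    P: "\<And>k. k > m \<Longrightarrow> coeff P k = 0" "coeff P m = cos (m * t)" and
    Q: "\<And>k. k > m \<Longrightarrow> coeff (pCons 0 Q) k = 0" "coeff (pCons 0 Q) m = sin (m * t)" and
    pw: "\<And>x y. x\<^sup>2 + y\<^sup>2 = N \<Longrightarrow>
      (x * cos t - y * sin t) ^ m = poly P x - y * poly Q x \<and>
      (x * cos t + y * sin t) ^ m = poly P x + y * poly Q x"
    by blast
  \<comment> \<open>Multiply P - y Q by x cos t - y sin t, replace y^2 by N - x^2, and collect the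
    even and odd parts.\<close>
  define P' where "P' = smult (cos t) (pCons 0 P) + smult (sin t) (smult N Q - pCons 0 (pCons 0 Q))"
  define Q' where "Q' = smult (cos t) (pCons 0 Q) + smult (sin t) P"
  have Q0: "coeff Q k = 0" if "k \<ge> m" for k
    using Q(1)[of "Suc k"] that by simp
  have "coeff P' k = 0" if "k > Suc m" for k
    using that P(1)[of "k - 1"] Q(1)[of "k - 1"] Q0[of k]
    by (cases k) (auto simp: P'_def)
  moreover have "coeff P' (Suc m) = cos (Suc m * t)"
    using P(2) Q(2) Q0[of "Suc m"] by (simp add: P'_def cos_add algebra_simps)
  moreover have "coeff (pCons 0 Q') k = 0" if "k > Suc m" for k
    using that P(1)[of "k - 1"] Q(1)[of "k - 1"] by (cases k) (auto simp: Q'_def simp del: smult_pCons)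
  moreover have "coeff (pCons 0 Q') (Suc m) = sin (Suc m * t)"
    using P(2) Q(2) by (simp add: Q'_def sin_add distrib_right add.commute del: smult_pCons)
  moreover have "(x * cos t - y * sin t) ^ Suc m = poly P' x - y * poly Q' x \<and>
      (x * cos t + y * sin t) ^ Suc m = poly P' x + y * poly Q' x" if "x\<^sup>2 + y\<^sup>2 = N" for x y
    unfolding power_Suc pw[OF that, THEN conjunct1] pw[OF that, THEN conjunct2]
    by (simp add: P'_def Q'_def that[symmetric] algebra_simps power2_eq_square)
  ultimately show ?case by blast
qed

text \<open>With u = (c - x cos \<delta>) / sin \<delta>, the prefactors are u + y and u - y, so the
  quotient equals P - u Q. Its top coefficient is cos (m t) + cot \<delta> sin (m t); the constant c
  enters only at lower degree. One G serves all points of the circle, hence all columns of the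
  determinant.\<close>

lemma moment_poly:
  fixes t N c \<delta> :: real
  assumes "sin \<delta> \<noteq> 0"
  obtains G :: "real poly" where "degree G \<le> m" "coeff G m = sin (m * t + \<delta>) / sin \<delta>"
    "\<And>x y. x\<^sup>2 + y\<^sup>2 = N \<Longrightarrow> y \<noteq> 0 \<Longrightarrow>
      ((c - (x * cos \<delta> - y * sin \<delta>)) / sin \<delta> * (x * cos t - y * sin t) ^ m
       - (c - (x * cos \<delta> + y * sin \<delta>)) / sin \<delta> * (x * cos t + y * sin t) ^ m) / (2 * y) = poly G x"
proof -
  obtain P Q :: "real poly" where
    P: "\<And>k. k > m \<Longrightarrow> coeff P k = 0" "coeff P m = cos (m * t)" and
    Q: "\<And>k. k > m \<Longrightarrow> coeff (pCons 0 Q) k = 0" "coeff (pCons 0 Q) m = sin (m * t)" and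
    pw: "\<And>x y. x\<^sup>2 + y\<^sup>2 = N \<Longrightarrow>
      (x * cos t - y * sin t) ^ m = poly P x - y * poly Q x \<and>
      (x * cos t + y * sin t) ^ m = poly P x + y * poly Q x"
    using cos_add_power_polys[of m t N] by blast
  define G where "G = P + smult (1 / sin \<delta>) (smult (cos \<delta>) (pCons 0 Q) - smult c Q)"
  have Q0: "coeff Q k = 0" if "k \<ge> m" for k
    using Q(1)[of "Suc k"] that by simp
  show thesis
  proof (rule that)
    show "degree G \<le> m"
      by (rule degree_le) (auto simp: G_def P Q Q0 simp del: smult_pCons)
    show "coeff G m = sin (m * t + \<delta>) / sin \<delta>"
      using assms P(2) Q(2) Q0[of m] by (simp add: G_def sin_add field_simps del: smult_pCons)
    show "((c - (x * cos \<delta> - y * sin \<delta>)) / sin \<delta> * (x * cos t - y * sin t) ^ m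
       - (c - (x * cos \<delta> + y * sin \<delta>)) / sin \<delta> * (x * cos t + y * sin t) ^ m) / (2 * y) = poly G x"
      if "x\<^sup>2 + y\<^sup>2 = N" "y \<noteq> 0" for x y
      unfolding pw[OF that(1), THEN conjunct1] pw[OF that(1), THEN conjunct2]
      using assms that(2) by (simp add: G_def field_simps)
  qed
qed

section \<open>Vandermonde determinants and expansion along the first row\<close>

text \<open>A kernel vector of the transpose lists the coefficients of a nonzero polynomial of
  degree at most l with l + 1 distinct roots.\<close>

lemma vandermonde_det_nonzero:
  fixes x :: "nat \<Rightarrow> real"
  assumes "inj_on x {..l}"
  shows "Determinant.det (Matrix.mat (l + 1) (l + 1) (\<lambda>(i, j). x j ^ (l - i))) \<noteq> 0"
proof
  define A where "A = Matrix.mat (l + 1) (l + 1) (\<lambda>(j, i). x j ^ (l - i))"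
  assume "Determinant.det (Matrix.mat (l + 1) (l + 1) (\<lambda>(i, j). x j ^ (l - i))) = 0"
  moreover have "Matrix.mat (l + 1) (l + 1) (\<lambda>(i, j). x j ^ (l - i)) = transpose_mat A"
    by (rule eq_matI) (auto simp: A_def)
  moreover have A: "A \<in> carrier_mat (l + 1) (l + 1)" by (simp add: A_def)
  ultimately have "Determinant.det A = 0" using Determinant.det_transpose[OF A] by simp
  then obtain v where v: "v \<in> carrier_vec (l + 1)" "v \<noteq> 0\<^sub>v (l + 1)" "A *\<^sub>v v = 0\<^sub>v (l + 1)"
    using det_0_iff_vec_prod_zero_field[OF A] by blast
  define p where "p = (\<Sum>i\<le>l. monom (vec_index v i) (l - i))"
  have "poly p (x j) = 0" if "j \<le> l" for j
  proof -
    have "poly p (x j) = (\<Sum>i = 0..<l + 1. x j ^ (l - i) * vec_index v i)"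
      by (simp add: p_def poly_sum poly_monom atLeast0LessThan lessThan_Suc_atMost mult.commute)
    also have "\<dots> = vec_index (A *\<^sub>v v) j"
      using that v(1) by (simp add: A_def scalar_prod_def)
    finally show ?thesis using v(3) that by simp
  qed
  moreover have "degree p \<le> l"
    unfolding p_def by (intro degree_sum_le) (auto intro: order.trans[OF degree_monom_le])
  moreover have "card (x ` {..l}) = l + 1"
    using assms by (simp add: card_image)
  ultimately have "p = 0"
    by (intro poly_eqI_degree[of "x ` {..l}"]) auto
  have "vec_index v i = 0" if "i \<le> l" for i
  proof -
    have "coeff p (l - i) = (\<Sum>k\<in>{i}. vec_index v k)"
      unfolding p_def coeff_sum coeff_monom using that
      by (intro sum.mono_neutral_cong_right) auto
    then show ?thesis using \<open>p = 0\<close> by simp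
  qed
  then have "v = 0\<^sub>v (l + 1)"
    using v(1) by (intro eq_vecI) auto
  with v(2) show False by simp
qed

text \<open>Laplace expansion makes the determinant a linear functional of its first row with
  weights \<open>c\<close>. It kills powers below l, which repeat another row, and sends the l-th
  power to the Vandermonde determinant \<open>V\<close>.\<close>

lemma det_first_row_functional:
  fixes x :: "nat \<Rightarrow> real"
  assumes "inj_on x {..l}"
  obtains V :: real and c :: "nat \<Rightarrow> real" where "V \<noteq> 0"
    "\<forall>f. Determinant.det (Matrix.mat (l + 1) (l + 1)
        (\<lambda>(i, j). if i = 0 then f j else x j ^ (l - i))) = (\<Sum>j\<le>l. f j * c j)"
    "\<forall>G. degree G \<le> l \<longrightarrow> (\<Sum>j\<le>l. poly G (x j) * c j) = coeff G l * V"
proof -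
  define A where "A f = Matrix.mat (l + 1) (l + 1) (\<lambda>(i, j). if i = 0 then f j else x j ^ (l - i))"
    for f :: "nat \<Rightarrow> real"
  \<comment> \<open>Cofactors along row 0 do not see that row, so the zero row is just a
    placeholder.\<close>
  define c where "c j = cofactor (A (\<lambda>_. 0)) 0 j" for j
  have A: "A f \<in> carrier_mat (l + 1) (l + 1)" for f by (simp add: A_def)
  have del: "mat_delete (A f) 0 j = mat_delete (A (\<lambda>_. 0)) 0 j" for f j
    by (rule eq_matI) (auto simp: A_def mat_delete_def)
  have cof: "cofactor (A f) 0 j = c j" for f j
    by (simp add: c_def cofactor_def del[of f])
  have det: "Determinant.det (A f) = (\<Sum>j\<le>l. f j * c j)" for f
  proof -
    have "Determinant.det (A f) = (\<Sum>j<l + 1. A f $$ (0, j) * cofactor (A f) 0 j)"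
      by (rule laplace_expansion_row[OF A]) simp
    also have "\<dots> = (\<Sum>j<l + 1. f j * c j)"
      unfolding cof by (intro sum.cong refl) (simp add: A_def)
    finally show ?thesis by (simp add: lessThan_Suc_atMost)
  qed
  define V where "V = (\<Sum>j\<le>l. x j ^ l * c j)"
  have low: "(\<Sum>j\<le>l. x j ^ m * c j) = 0" if "m < l" for m
  proof -
    \<comment> \<open>Row l - m carries the exponent m, and it differs from row 0 because m <
      l.\<close>
    have "Matrix.row (A (\<lambda>j. x j ^ m)) 0 = Matrix.row (A (\<lambda>j. x j ^ m)) (l - m)"
      using that by (intro eq_vecI) (auto simp: A_def)
    then have "Determinant.det (A (\<lambda>j. x j ^ m)) = 0"
      using that by (intro Determinant.det_identical_rows[OF A, of 0 "l - m"]) auto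
    then show ?thesis by (simp add: det)
  qed
  have "A (\<lambda>j. x j ^ l) = Matrix.mat (l + 1) (l + 1) (\<lambda>(i, j). x j ^ (l - i))"
    by (rule eq_matI) (auto simp: A_def)
  then have "V \<noteq> 0"
    using vandermonde_det_nonzero[OF assms] det[of "\<lambda>j. x j ^ l"] by (simp add: V_def)
  moreover have "(\<Sum>j\<le>l. poly G (x j) * c j) = coeff G l * V" if "degree G \<le> l" for G
  proof -
    have poly_G: "poly G z = (\<Sum>m\<le>l. coeff G m * z ^ m)" for z
      unfolding poly_altdef using that by (intro sum.mono_neutral_left) (auto simp: coeff_eq_0)
    have "(\<Sum>j\<le>l. poly G (x j) * c j) = (\<Sum>j\<le>l. \<Sum>m\<le>l. coeff G m * (x j ^ m * c j))"
      unfolding poly_G sum_distrib_right by (simp add: mult.assoc)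
    also have "\<dots> = (\<Sum>m\<le>l. coeff G m * (\<Sum>j\<le>l. x j ^ m * c j))"
      by (subst sum.swap) (simp add: sum_distrib_left)
    also have "\<dots> = (\<Sum>m\<in>{l}. coeff G m * (\<Sum>j\<le>l. x j ^ m * c j))"
      by (intro sum.mono_neutral_right) (auto simp: low)
    finally show ?thesis by (simp add: V_def)
  qed
  ultimately show thesis
    using det unfolding A_def by (intro that allI impI)
qed

section \<open>Rotations, reflections and polar coordinates\<close>

lemma rho_mult_w: "rho a *v w b = w (a + b)"
  by (simp add: vec_eq_iff forall_2 rho_def w_def matrix_vector_mult_def sum_2 cos_add sin_add)

lemma Refl_mult_w: "Refl a *v w b = w (2 * a - b)"
  by (simp add: vec_eq_iff forall_2 Refl_def w_def matrix_vector_mult_def sum_2 cos_diff sin_diff)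

lemma Rot_mult_w: "Rot \<delta> \<xi> j *v w t = w (2 * \<delta> + 2 * real j * \<xi> + t)"
  by (simp add: Rot_def rho_mult_w)

text \<open>The reflection turns the angle t into 2 \<xi> - t, and this 2 \<xi> makes up for the
  shift j - 1 in \<open>Ref\<close>.\<close>

lemma Ref_mult_w: "Ref \<delta> \<xi> j *v w t = w (2 * \<delta> + 2 * real j * \<xi> - t)"
  by (simp add: Ref_def matrix_vector_mul_assoc[symmetric] Refl_mult_w rho_mult_w algebra_simps)

lemma inner_w_w: "w a \<bullet> w b = cos (b - a)"
  by (simp add: w_def inner_vec_def sum_2 cos_diff mult.commute)

lemma e1_eq_w: "e1 = w 0"
  by (simp add: e1_def w_def)

lemma polar_form: "\<mu> = norm \<mu> *\<^sub>R w (theta_of \<mu>)"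
proof -
  define z where "z = Complex (\<mu> $ 1) (\<mu> $ 2)"
  have "cmod z = norm \<mu>"
    by (simp add: z_def cmod_def norm_vec_def L2_set_def sum_2)
  moreover have "z = rcis (cmod z) (Arg z)"
    by (simp add: rcis_cmod_Arg)
  ultimately have "Re z = norm \<mu> * cos (Arg z)" "Im z = norm \<mu> * sin (Arg z)"
    by (metis Re_rcis, metis Im_rcis)
  then show ?thesis
    by (simp add: vec_eq_iff forall_2 theta_of_def w_def z_def)
qed

text \<open>Pairing \<open>s *\<^sub>R w \<phi>\<close> with the images of \<open>w u\<close> under
  \<open>Rot\<close> and \<open>Ref\<close> gives s cos (\<beta> + u) and s cos (\<beta> - u), which
  differ only in the sign of y. At u = \<delta> their difference is 2 y sin \<delta>, and the
  normalization of \<open>v1\<close> cancels sin \<delta>.\<close>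

lemma pi_comp_polar:
  fixes s \<phi> \<delta> \<xi> :: real and j :: nat
  assumes "sin \<delta> \<noteq> 0"
  defines "\<beta> \<equiv> 2 * \<delta> + 2 * real j * \<xi> - \<phi>"
  defines "x \<equiv> s * cos \<beta>" and "y \<equiv> s * sin \<beta>" and "c \<equiv> s * cos (\<delta> - \<phi>)"
  shows "pi_comp \<delta> \<xi> (s *\<^sub>R w \<phi>) j (r *\<^sub>R w t) = exp (- (r * (s * cos (t - \<phi>)))) *
     (((c - (x * cos \<delta> - y * sin \<delta>)) / sin \<delta> * exp (r * (x * cos t - y * sin t))
       - (c - (x * cos \<delta> + y * sin \<delta>)) / sin \<delta> * exp (r * (x * cos t + y * sin t))) / (2 * y))"
proof -
  have rot: "s *\<^sub>R w \<phi> \<bullet> (Rot \<delta> \<xi> j *v w u) = x * cos u - y * sin u" for u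
  proof -
    have "s *\<^sub>R w \<phi> \<bullet> (Rot \<delta> \<xi> j *v w u) = s * cos (\<beta> + u)"
      by (simp add: Rot_mult_w inner_w_w \<beta>_def algebra_simps)
    then show ?thesis by (simp add: cos_add x_def y_def right_diff_distrib)
  qed
  have ref: "s *\<^sub>R w \<phi> \<bullet> (Ref \<delta> \<xi> j *v w u) = x * cos u + y * sin u" for u
  proof -
    have "s *\<^sub>R w \<phi> \<bullet> (Ref \<delta> \<xi> j *v w u) = s * cos (\<beta> - u)"
      by (simp add: Ref_mult_w inner_w_w \<beta>_def algebra_simps)
    then show ?thesis by (simp add: cos_diff x_def y_def distrib_left)
  qed
  have inn: "s *\<^sub>R w \<phi> \<bullet> w u = s * cos (u - \<phi>)" for u
    by (simp add: inner_w_w)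
  have den: "s *\<^sub>R w \<phi> \<bullet> ((Ref \<delta> \<xi> j - Rot \<delta> \<xi> j) *v v1 \<delta>) = 2 * y"
    using assms(1)
    by (simp add: v1_def matrix_vector_mult_diff_rdistrib matrix_vector_mult_scaleR inner_diff_right
        rot ref del: inner_scaleR_left)
  have A: "s *\<^sub>R w \<phi> \<bullet> ((mat 1 - Rot \<delta> \<xi> j) *v (k *\<^sub>R w u)) = k * (s * cos (u - \<phi>) - (x * cos u - y * sin u))"
    for u k
    by (simp add: matrix_vector_mult_diff_rdistrib matrix_vector_mult_scaleR inner_diff_right
        rot inn right_diff_distrib del: inner_scaleR_left)
  have B: "s *\<^sub>R w \<phi> \<bullet> ((mat 1 - Ref \<delta> \<xi> j) *v (k *\<^sub>R w u)) = k * (s * cos (u - \<phi>) - (x * cos u + y * sin u))"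
    for u k
    by (simp add: matrix_vector_mult_diff_rdistrib matrix_vector_mult_scaleR inner_diff_right
        ref inn right_diff_distrib del: inner_scaleR_left)
  \<comment> \<open>The identity in I - Rot and I - Ref contributes the same exponential to both
    terms.\<close>
  have split: "exp (- (r * (p - q))) = exp (- (r * p)) * exp (r * q)" for p q :: real
    by (simp add: exp_add[symmetric] algebra_simps)
  have factor: "(1 / d * p * (E * X) - 1 / d * q * (E * Y)) / z = E * ((p / d * X - q / d * Y) / z)"
    for d p q E X Y z :: real
    by (simp add: divide_inverse algebra_simps)
  show ?thesis
    unfolding pi_comp_def v1_def den[unfolded v1_def] A B split c_def by (rule factor)
qed

section \<open>Nondegeneracy of the nodes and the limit of the determinant\<close>

theorem proposition1:
  fixes \<delta> \<epsilon> \<xi> :: real and l :: nat and \<mu> :: "real^2"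
  assumes "0 < \<delta>" "\<delta> < pi" "0 < \<epsilon>" "\<epsilon> < pi" "0 < \<xi>" "\<xi> < pi"
    and "- alpha \<delta> \<epsilon> \<xi> = real l" and "l \<ge> 1"
    and "\<mu> \<noteq> 0" and "theta_of \<mu> \<in> Theta \<delta> \<epsilon> \<xi> l"
  shows "\<exists>C::real. C \<noteq> 0 \<and>
    (\<forall>\<theta>\<in>{0..\<xi>}. (\<lambda>r. pi_mu \<delta> \<xi> l \<mu> (r *\<^sub>R w \<theta>))
       \<sim>[at_right 0] (\<lambda>r. C * r ^ l * sin (real l * \<theta> + \<delta>)))"
proof -
  define s where "s = norm \<mu>"
  define \<phi> where "\<phi> = theta_of \<mu>"
  define \<beta> where "\<beta> j = 2 * \<delta> + 2 * real j * \<xi> - \<phi>" for j :: nat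
  define x where "x j = s * cos (\<beta> j)" for j
  define y where "y j = s * sin (\<beta> j)" for j
  define c where "c = s * cos (\<delta> - \<phi>)"
  have s: "s > 0" using \<open>\<mu> \<noteq> 0\<close> by (simp add: s_def)
  have \<mu>: "\<mu> = s *\<^sub>R w \<phi>" unfolding s_def \<phi>_def by (rule polar_form)
  \<comment> \<open>This bounds both the gaps (j - i) \<xi> and the angles l \<theta> + \<delta>
    strictly below \<pi>.\<close>
  have lxi: "real l * \<xi> = pi - \<delta> - \<epsilon>"
    using assms(5,7) by (simp add: alpha_def field_simps)
  have sd: "sin \<delta> > 0" using assms(1,2) by (rule sin_gt_zero)
  \<comment> \<open>Even indices k = 2 j will give \<open>y j \<noteq> 0\<close>, and k = i + j will
    separate \<open>x i\<close> from \<open>x j\<close>.\<close>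
  have nz: "sin (2 * \<delta> + real k * \<xi> - \<phi>) \<noteq> 0" if "k \<le> 2 * l" for k
  proof -
    have "sin (\<phi> - 2 * \<delta> - real k * \<xi>) \<noteq> 0"
      using assms(10) that by (auto simp: Theta_def \<phi>_def)
    then show ?thesis
      using sin_minus[of "\<phi> - 2 * \<delta> - real k * \<xi>"] by (simp add: algebra_simps)
  qed
  have y0: "y j \<noteq> 0" if "j \<le> l" for j
    using nz[of "2 * j"] that s by (simp add: y_def \<beta>_def)
  have xy: "(x j)\<^sup>2 + (y j)\<^sup>2 = s\<^sup>2" for j
    by (simp add: x_def y_def power_mult_distrib distrib_left[symmetric])
  \<comment> \<open>The difference of cosines factors into the sine excluded from vanishing by
    \<open>Theta\<close> and the sine of (j - i) \<xi>, an angle in (0, \<pi>).\<close>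
  have neq: "x i \<noteq> x j" if "i < j" "j \<le> l" for i j
  proof -
    have "0 < (real j - real i) * \<xi>" using that assms(5) by simp
    moreover have "(real j - real i) * \<xi> \<le> real l * \<xi>"
      using that assms(5) by (intro mult_right_mono) auto
    ultimately have "sin ((real j - real i) * \<xi>) > 0"
      using lxi assms(1,3) by (intro sin_gt_zero) auto
    moreover have "cos (\<beta> i) - cos (\<beta> j) = 2 * sin (2 * \<delta> + real (i + j) * \<xi> - \<phi>) * sin ((real j - real i) * \<xi>)"
    proof -
      have half: "(\<beta> i + \<beta> j) / 2 = 2 * \<delta> + real (i + j) * \<xi> - \<phi>" "(\<beta> j - \<beta> i) / 2 = (real j - real i) * \<xi>"
        by (simp_all add: \<beta>_def field_simps)
      show ?thesis
        using cos_diff_cos[of "\<beta> i" "\<beta> j"] unfolding half .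
    qed
    ultimately show ?thesis
      using nz[of "i + j"] that s by (auto simp: x_def)
  qed
  have inj: "inj_on x {..l}"
    by (rule linorder_inj_onI) (use neq in auto)
  have rot: "\<mu> \<bullet> (Rot \<delta> \<xi> j *v e1) = x j" for j
    by (simp add: \<mu> e1_eq_w Rot_mult_w inner_w_w x_def \<beta>_def)
  obtain V C where
    V: "V \<noteq> 0" and
    det: "\<forall>f. Determinant.det (Matrix.mat (l + 1) (l + 1)
        (\<lambda>(i, j). if i = 0 then f j else x j ^ (l - i))) = (\<Sum>j\<le>l. f j * C j)" and
    lin: "\<forall>G. degree G \<le> l \<longrightarrow> (\<Sum>j\<le>l. poly G (x j) * C j) = coeff G l * V"
    by (rule det_first_row_functional[OF inj]) (rule that)
  \<comment> \<open>The l-th moment is sin (l \<theta> + \<delta>) V / sin \<delta>, and Taylor's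
    formula divides it by l!. The nodes \<open>x j\<close>, hence \<open>V\<close> and
    \<open>K\<close>, do not involve \<theta>.\<close>
  define K where "K = V / (sin \<delta> * fact l)"
  have "(\<lambda>r. pi_mu \<delta> \<xi> l \<mu> (r *\<^sub>R w \<theta>)) \<sim>[at_right 0] (\<lambda>r. K * r ^ l * sin (real l * \<theta> + \<delta>))"
    if "\<theta> \<in> {0..\<xi>}" for \<theta>
  proof -
    define A where "A j = (c - (x j * cos \<delta> - y j * sin \<delta>)) / sin \<delta>" for j
    define B where "B j = (c - (x j * cos \<delta> + y j * sin \<delta>)) / sin \<delta>" for j
    define a where "a j = x j * cos \<theta> - y j * sin \<theta>" for j
    define b where "b j = x j * cos \<theta> + y j * sin \<theta>" for j
    define F where "F r = (\<Sum>j\<le>l. (A j * exp (r * a j) - B j * exp (r * b j)) / (2 * y j) * C j)" for r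
    define S where "S = sin (real l * \<theta> + \<delta>)"
    have pi: "pi_mu \<delta> \<xi> l \<mu> (r *\<^sub>R w \<theta>) = exp (- (r * (s * cos (\<theta> - \<phi>)))) * F r" for r
      unfolding pi_mu_def rot det[rule_format] F_def sum_distrib_left
      using sd by (intro sum.cong refl)
        (simp add: \<mu> pi_comp_polar A_def B_def a_def b_def c_def x_def y_def \<beta>_def)
    \<comment> \<open>The moment is the functional applied to a polynomial of degree at most m,
      whose coefficient at l is zero unless m = l.\<close>
    have moment: "(\<Sum>j\<le>l. (A j * a j ^ m - B j * b j ^ m) / (2 * y j) * C j)
        = (if m = l then S / sin \<delta> * V else 0)" if "m \<le> l" for m
    proof -
      obtain G where G: "degree G \<le> m" "coeff G m = sin (m * \<theta> + \<delta>) / sin \<delta>"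
        "\<And>x y. x\<^sup>2 + y\<^sup>2 = s\<^sup>2 \<Longrightarrow> y \<noteq> 0 \<Longrightarrow>
          ((c - (x * cos \<delta> - y * sin \<delta>)) / sin \<delta> * (x * cos \<theta> - y * sin \<theta>) ^ m
           - (c - (x * cos \<delta> + y * sin \<delta>)) / sin \<delta> * (x * cos \<theta> + y * sin \<theta>) ^ m) / (2 * y) = poly G x"
        by (rule moment_poly[of \<delta> m \<theta> "s\<^sup>2" c]) (use sd in auto)
      have "(\<Sum>j\<le>l. (A j * a j ^ m - B j * b j ^ m) / (2 * y j) * C j) = (\<Sum>j\<le>l. poly G (x j) * C j)"
        unfolding A_def B_def a_def b_def using G(3)[OF xy y0] by (intro sum.cong refl) simp
      also have "\<dots> = coeff G l * V"
        using G(1) that by (intro lin[rule_format]) simp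
      finally show ?thesis
        using G(1,2) that by (auto simp: S_def coeff_eq_0)
    qed
    \<comment> \<open>Thus l \<theta> + \<delta> lies between \<delta> and \<pi> - \<epsilon>. The
      positive sine makes the limit \<open>K * S\<close> nonzero, as asymptotic equivalence
      requires.\<close>
    have "real l * \<theta> \<le> real l * \<xi>" "0 \<le> real l * \<theta>"
      using that by (auto intro: mult_left_mono)
    then have S: "S > 0"
      unfolding S_def using lxi assms(1,3) by (intro sin_gt_zero) linarith+
    have "((\<lambda>r. F r / r ^ l) \<longlongrightarrow> S / sin \<delta> * V / fact l) (at_right 0)"
      \<comment> \<open>The limit is turned back into the l-th moment to match
        \<open>exp_sum_tendsto\<close>.\<close>
      unfolding F_def moment[OF order_refl, unfolded if_P[OF refl], symmetric]
      by (rule exp_sum_tendsto, subst moment) auto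
    moreover have "((\<lambda>r. exp (- (r * (s * cos (\<theta> - \<phi>))))) \<longlongrightarrow> 1) (at_right 0)"
      by (auto intro!: tendsto_eq_intros)
    ultimately have "((\<lambda>r. exp (- (r * (s * cos (\<theta> - \<phi>)))) * (F r / r ^ l)) \<longlongrightarrow> 1 * (S / sin \<delta> * V / fact l))
        (at_right 0)"
      by (intro tendsto_mult)
    then have "((\<lambda>r. pi_mu \<delta> \<xi> l \<mu> (r *\<^sub>R w \<theta>) / r ^ l) \<longlongrightarrow> K * S) (at_right 0)"
      by (simp add: pi K_def mult_ac)
    from asymp_equivI'_const[OF this] S sd V show ?thesis
      by (simp add: K_def S_def mult_ac)
  qed
  moreover have "K \<noteq> 0" using V sd by (simp add: K_def)
  ultimately show ?thesis by blast
qed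

end
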